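(* Let $n\ge 0$, $k\in\mathbb{Z}$ and $a\in\mathbb{C}$ with $a\neq0$. Then \[ PC_{n}^{(k)}(x:a)=\sum_{l=0}^{n}\left\{\sum_{r=0}^{n-l}\frac{(-1)^{l}}{a^{n-r}}\binom{n}{r}S_{1}(n-r,l)\,PC_{r}^{(k)}(0:a)\right\}x^{l}. \]
   Context: For an integer $k$, $\mathrm{Lif}_k(t)=\sum_{n=0}^{\infty}\frac{t^{n}}{n!\,(n+1)^{k}}$. For $a\neq0$, $PC_n^{(k)}(x:a)$ is defined by $e^{-t}\,\mathrm{Lif}_k\!\left(\log\left(1+\frac{t}{a}\right)\right)\left(1+\frac{t}{a}\right)^{-x}=\sum_{n\ge0}PC_n^{(k)}(x:a)\frac{t^n}{n!}$; $PC_r^{(k)}(0:a)$ is its value at $x=0$. $S_1(n,l)$ denotes the (signed) Stirling numbers of the first kind, defined by $x(x-1)\cdots(x-n+1)=\sum_{l=0}^{n}S_1(n,l)x^l$. *)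

theory Defs
  imports Complex_Main "HOL-Computational_Algebra.Computational_Algebra"
begin

definition Lif :: "int \<Rightarrow> complex fps" where
  "Lif k = Abs_fps (\<lambda>n. 1 / (fact n * of_nat (n + 1) powi k))"

text \<open>Here \<open>fps_ln 1\<close> is the expansion of \<open>log (1 + t)\<close>, not of \<open>log t\<close>, and
  \<open>fps_binomial c\<close> that of \<open>(1 + t)\<close> to the power \<open>c\<close>; both are taken at \<open>t / a\<close>, which
  has no constant term, so that all compositions below are meaningful.\<close>

definition PC_gf :: "int \<Rightarrow> complex \<Rightarrow> complex \<Rightarrow> complex fps" where
  "PC_gf k x a =
     fps_exp (- 1) * (Lif k oo (fps_ln 1 oo (fps_const (1 / a) * fps_X)))
       * (fps_binomial (- x) oo (fps_const (1 / a) * fps_X))"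

definition PC :: "nat \<Rightarrow> int \<Rightarrow> complex \<Rightarrow> complex \<Rightarrow> complex" where
  "PC n k x a = fact n * fps_nth (PC_gf k x a) n"

lemma PC_gf_eq: "PC_gf k x a = Abs_fps (\<lambda>n. PC n k x a / fact n)"
  by (simp add: fps_eq_iff PC_def)

definition S1 :: "nat \<Rightarrow> nat \<Rightarrow> int" where
  "S1 n l = coeff (\<Prod>i<n. [:- int i, 1:]) l"

lemma S1_falling_factorial:
  fixes x :: int
  shows "(\<Prod>i<n. x - int i) = (\<Sum>l = 0..n. S1 n l * x ^ l)"
proof -
  define p where "p = (\<Prod>i<n. [:- int i, 1:])"
  have deg: "degree p \<le> n"
    using degree_prod_sum_le[of "{..<n}" "\<lambda>i. [:- int i, 1:]"] by (simp add: p_def)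
  have "(\<Prod>i<n. x - int i) = poly p x"
    by (simp add: p_def poly_prod)
  also have "\<dots> = (\<Sum>l\<le>degree p. coeff p l * x ^ l)"
    by (rule poly_altdef)
  also have "\<dots> = (\<Sum>l = 0..n. coeff p l * x ^ l)"
    using deg by (intro sum.mono_neutral_left) (auto simp: coeff_eq_0)
  finally show ?thesis by (simp add: S1_def p_def)
qed

end

theory Submission
  imports Defs
begin

text \<open>The variable x enters the generating function only through the factor (1 + t/a)^(-x),
  whose coefficient of t^m is binom(-x, m) / a^m. Binomial convolution with the series at x = 0
  gives \<open>PC_eq_sum_gbinomial\<close>. Since m! binom(-x, m) is the falling factorial of -x,
  \<open>gbinomial_eq_sum_S1\<close> turns it into a polynomial in x; collecting powers of x gives
  the formula.\<close>

lemma degree_falling_factorial_le: "degree (\<Prod>i<n. [:- int i, 1:]) \<le> n"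
  using degree_prod_sum_le[of "{..<n}" "\<lambda>i. [:- int i, 1:]"] by simp

lemma S1_eq_0: "n < l \<Longrightarrow> S1 n l = 0"
  unfolding S1_def by (rule coeff_eq_0) (use degree_falling_factorial_le[of n] in simp)

text \<open>Coefficient comparison after multiplying the n-th falling factorial polynomial by X -
  n.\<close>

lemma S1_Suc: "S1 (Suc n) l = (case l of 0 \<Rightarrow> 0 | Suc j \<Rightarrow> S1 n j) - int n * S1 n l"
  by (simp add: S1_def mult.commute split: nat.splits)

text \<open>\<open>S1_falling_factorial\<close> covers integer arguments only, whereas the complex
  value -x is needed; the recurrence \<open>S1_Suc\<close> carries the identity to any commutative
  ring.\<close>

lemma falling_factorial_eq_sum_S1:
  fixes y :: "'a::comm_ring_1"
  shows "(\<Prod>i<n. y - of_nat i) = (\<Sum>l\<le>n. of_int (S1 n l) * y ^ l)"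
proof (induction n)
  case 0
  show ?case by (simp add: S1_def)
next
  case (Suc n)
  have "(\<Sum>l\<le>Suc n. of_int (S1 (Suc n) l) * y ^ l)
      = (\<Sum>l\<le>Suc n. of_int (case l of 0 \<Rightarrow> 0 | Suc j \<Rightarrow> S1 n j) * y ^ l)
        - of_nat n * (\<Sum>l\<le>Suc n. of_int (S1 n l) * y ^ l)"
    by (simp only: S1_Suc of_int_diff of_int_mult of_int_of_nat_eq left_diff_distrib
        sum_subtractf sum_distrib_left mult.assoc)
  also have "(\<Sum>l\<le>Suc n. of_int (case l of 0 \<Rightarrow> 0 | Suc j \<Rightarrow> S1 n j) * y ^ l)
      = y * (\<Sum>l\<le>n. of_int (S1 n l) * y ^ l)"
    by (subst sum.atMost_Suc_shift) (simp add: sum_distrib_left mult.left_commute)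
  \<comment> \<open>The top term drops out, as the polynomial has degree at most n.\<close>
  also have "(\<Sum>l\<le>Suc n. of_int (S1 n l) * y ^ l) = (\<Sum>l\<le>n. of_int (S1 n l) * y ^ l)"
    by (simp add: S1_eq_0)
  finally show ?case
    by (simp add: Suc.IH algebra_simps)
qed

lemma gbinomial_eq_sum_S1:
  fixes y :: "'a::field_char_0"
  shows "y gchoose m = (\<Sum>l\<le>m. of_int (S1 m l) * y ^ l) / fact m"
  by (simp add: gbinomial_prod_rev atLeast0LessThan flip: falling_factorial_eq_sum_S1)

text \<open>At x = 0 the binomial factor is 1.\<close>

lemma PC_gf_split:
  "PC_gf k x a = PC_gf k 0 a * (fps_binomial (- x) oo (fps_const (1 / a) * fps_X))"
  by (simp add: PC_gf_def)

text \<open>Cauchy product of the two factors in \<open>PC_gf_split\<close>, with n! = binom(n, r)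
  r! (n - r)!.\<close>

lemma PC_eq_sum_gbinomial:
  "PC n k x a = (\<Sum>r\<le>n. of_nat (n choose r) * PC r k 0 a
      * (fact (n - r) * ((- x) gchoose (n - r)) / a ^ (n - r)))"
proof -
  have "PC n k x a = (\<Sum>r\<le>n. fact n * (fps_nth (PC_gf k 0 a) r
      * ((1 / a) ^ (n - r) * ((- x) gchoose (n - r)))))"
    by (subst PC_def, subst PC_gf_split)
       (simp add: fps_mult_nth fps_compose_linear sum_distrib_left atLeast0AtMost)
  also have "\<dots> = (\<Sum>r\<le>n. of_nat (n choose r) * PC r k 0 a
      * (fact (n - r) * ((- x) gchoose (n - r)) / a ^ (n - r)))"
    by (intro sum.cong refl)
       (simp add: PC_def binomial_fact power_one_over field_simps)
  finally show ?thesis .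
qed

theorem theorem4:
  fixes n :: nat and k :: int and a x :: complex
  assumes "a \<noteq> 0"
  shows "PC n k x a =
    (\<Sum>l = 0..n. (\<Sum>r = 0..n - l.
        (- 1) ^ l / a ^ (n - r) * of_nat (n choose r) * of_int (S1 (n - r) l) * PC r k 0 a) * x ^ l)"
proof -
  define c where "c r l = (- 1) ^ l / a ^ (n - r) * of_nat (n choose r)
    * of_int (S1 (n - r) l) * PC r k 0 a * x ^ l" for r l
  \<comment> \<open>The factor (n - r)! cancels, and (-x)^l supplies the sign (-1)^l.\<close>
  have "PC n k x a = (\<Sum>r\<le>n. \<Sum>l\<le>n - r. c r l)"
    unfolding PC_eq_sum_gbinomial[of n] gbinomial_eq_sum_S1 c_def
    by (intro sum.cong refl)
       (simp add: sum_distrib_left sum_distrib_right sum_divide_distrib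
         power_minus[of x] mult_ac)
  \<comment> \<open>Both double sums run over the triangle r + l \<le> n.\<close>
  also have "\<dots> = (\<Sum>l\<le>n. \<Sum>r\<le>n - l. c r l)"
    unfolding sum.Sigma[OF finite_atMost ballI[OF finite_atMost]]
    by (rule sum.reindex_bij_witness[of _ prod.swap prod.swap]) auto
  finally show ?thesis
    by (simp add: c_def atLeast0AtMost sum_distrib_right)
qed

end
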